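(* Let $(X,\mu)$ be a computable probability space and $n\ge 1$. If $x\in X$ is weakly $n$-random, then for any $\Sigma^0_n$ set $A$ (not necessarily containing $x$) with $\mu(A)>0$ and any computable ergodic measure-preserving transformation $T:\subseteq X\to X$ with $x\in\operatorname{dom}T$, we have $T^k(x)\in A$ for some $k>0$.
   Context: Uniformity: a sequence of objects has a property (whose definition involves an index in $\mathbb N$) uniformly if a computable function produces suitable indices. A computable metric space is a triple $(X,d,S)$ where $(X,d)$ is a complete separable metric space, $S=(s_i)_i$ is a dense sequence in $X$, and $d(s_i,s_j)$ is a computable real number uniformly in $i,j$. With $(q_j)_j$ a fixed enumeration of the positive rationals and $\langle\cdot,\cdot\rangle$ the standard pairing function, the ideal balls are $B_{\langle i,j\rangle}=\{x\in X: d(x,s_i)<q_j\}$. A set $U\subseteq X$ is $\Sigma^0_1$ if $U=\bigcup_{i\in W}B_i$ for some c.e. $W\subseteq\mathbb N$ (its index is an index of $W$). A set is $\Pi^0_n$ if its complement is $\Sigma^0_n$. A set is $\Sigma^0_{n+1}$ if it equals $\bigcup_{i\in W}(X\setminus U^n_i)$ for some c.e. $W\subseteq\mathbb N$, where $U^n_i$ is the $i$-th $\Sigma^0_n$ set. For $D\subseteq X$, a subset of $D$ is $\Sigma^0_n$ in $D$ if it is the intersection of $D$ with a $\Sigma^0_n$ subset of $X$. A computable probability space $(X,\mu)$ is a computable metric space with a Borel probability measure $\mu$ such that $\mu(\bigcup_{i\in F}B_i)$ is lower-semicomputable uniformly in finite $F\subseteq\mathbb N$. A point is weakly $n$-random if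 it lies in no $\mu$-null $\Pi^0_n$ set. A measure-preserving transformation is a partial Borel measurable map $T:\subseteq X\to X$ such that $\mu(T^{-1}(B))=\mu(B)$ for every Borel $B$ (so $\operatorname{dom}T$ has full measure) and $x\in\operatorname{dom}T$ implies $T(x)\in\operatorname{dom}T$. It is computable if the sets $T^{-1}(B_i)$ are uniformly $\Sigma^0_1$ in $\operatorname{dom}T$. It is ergodic if every Borel $B$ with $T^{-1}(B)=B$ has measure $0$ or $1$. *)

theory Defs
  imports "HOL-Probability.Probability" "HOL-Library.Nat_Bijection"
begin

section \<open>Partial recursive functions and c.e. sets\<close>

text \<open>
  Partial recursive functions in unary form: several arguments, and several results, are packed
  into one number by the Cantor pairing \<^const>\<open>prod_encode\<close>, whose two projections are therefore
  among the initial functions.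
\<close>

datatype recf =
    RZero | RSucc | RFst | RSnd
  | RPair recf recf | RComp recf recf | RPrec recf recf | RMu recf

primrec recf_eval :: "recf \<Rightarrow> nat \<Rightarrow> nat option" where
  "recf_eval RZero x = Some 0"
| "recf_eval RSucc x = Some (Suc x)"
| "recf_eval RFst x = Some (fst (prod_decode x))"
| "recf_eval RSnd x = Some (snd (prod_decode x))"
| "recf_eval (RPair f g) x =
     Option.bind (recf_eval f x) (\<lambda>a. Option.bind (recf_eval g x) (\<lambda>b. Some (prod_encode (a, b))))"
| "recf_eval (RComp f g) x = Option.bind (recf_eval g x) (recf_eval f)"
| "recf_eval (RPrec f g) x =
     (case prod_decode x of (a, n) \<Rightarrow>
       rec_nat (recf_eval f a)
         (\<lambda>m r. Option.bind r (\<lambda>v. recf_eval g (prod_encode (a, prod_encode (m, v))))) n)"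
| "recf_eval (RMu f) x =
     (if \<exists>n. recf_eval f (prod_encode (x, n)) = Some 0 \<and>
             (\<forall>m<n. \<exists>k. recf_eval f (prod_encode (x, m)) = Some (Suc k))
      then Some (LEAST n. recf_eval f (prod_encode (x, n)) = Some 0)
      else None)"

lemma prod_decode_snd_less:
  assumes "(t, r) = prod_decode e" "0 < t"
  shows "r < e"
proof -
  have "e = prod_encode (t, r)"
    using assms by (metis prod_decode_inverse)
  moreover have "r \<le> triangle (t + r)"
    using le_prod_encode_2[of r 0] assms(2) by (induction r) (auto simp: prod_encode_def)
  ultimately show ?thesis
    using assms(2) by (simp add: prod_encode_def)
qed

lemma prod_decode_fst_le: "fst (prod_decode r) \<le> r"
  by (metis le_prod_encode_1 prod.collapse prod_decode_inverse)

lemma prod_decode_snd_le: "snd (prod_decode r) \<le> r"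
  by (metis le_prod_encode_2 prod.collapse prod_decode_inverse)

text \<open>Every number is the Goedel number of a program; the first component is the constructor tag.\<close>

function recf_of_nat :: "nat \<Rightarrow> recf" where
  "recf_of_nat e = (case prod_decode e of (t, r) \<Rightarrow>
     (let a = fst (prod_decode r); b = snd (prod_decode r) in
      if t = 0 then RZero
      else if t = 1 then RSucc
      else if t = 2 then RFst
      else if t = 3 then RSnd
      else if t = 4 then RPair (recf_of_nat a) (recf_of_nat b)
      else if t = 5 then RComp (recf_of_nat a) (recf_of_nat b)
      else if t = 6 then RPrec (recf_of_nat a) (recf_of_nat b)
      else RMu (recf_of_nat r)))"
  by pat_completeness auto
termination
  by (relation less_than)
     (auto intro: le_less_trans[OF prod_decode_fst_le prod_decode_snd_less]
        le_less_trans[OF prod_decode_snd_le prod_decode_snd_less] prod_decode_snd_less)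

declare recf_of_nat.simps [simp del]

lemma surj_recf_of_nat: "surj recf_of_nat"
proof -
  have "\<exists>e. recf_of_nat e = c" for c
  proof (induction c)
    case RZero
    show ?case by (rule exI[of _ "prod_encode (0, 0)"]) (subst recf_of_nat.simps, simp)
  next
    case RSucc
    show ?case by (rule exI[of _ "prod_encode (1, 0)"]) (subst recf_of_nat.simps, simp)
  next
    case RFst
    show ?case by (rule exI[of _ "prod_encode (2, 0)"]) (subst recf_of_nat.simps, simp)
  next
    case RSnd
    show ?case by (rule exI[of _ "prod_encode (3, 0)"]) (subst recf_of_nat.simps, simp)
  next
    case (RPair f g)
    then obtain a b where "recf_of_nat a = f" "recf_of_nat b = g" by blast
    then show ?case
      by (intro exI[of _ "prod_encode (4, prod_encode (a, b))"]) (subst recf_of_nat.simps, simp)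
  next
    case (RComp f g)
    then obtain a b where "recf_of_nat a = f" "recf_of_nat b = g" by blast
    then show ?case
      by (intro exI[of _ "prod_encode (5, prod_encode (a, b))"]) (subst recf_of_nat.simps, simp)
  next
    case (RPrec f g)
    then obtain a b where "recf_of_nat a = f" "recf_of_nat b = g" by blast
    then show ?case
      by (intro exI[of _ "prod_encode (6, prod_encode (a, b))"]) (subst recf_of_nat.simps, simp)
  next
    case (RMu f)
    then obtain a where "recf_of_nat a = f" by blast
    then show ?case
      by (intro exI[of _ "prod_encode (7, a)"]) (subst recf_of_nat.simps, simp)
  qed
  then show ?thesis by (metis surjI)
qed

definition phi :: "nat \<Rightarrow> nat \<Rightarrow> nat option" where
  "phi e = recf_eval (recf_of_nat e)"

definition computable_fun :: "(nat \<Rightarrow> nat) \<Rightarrow> bool" where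
  "computable_fun f \<longleftrightarrow> (\<exists>e. \<forall>x. phi e x = Some (f x))"

text \<open>The set enumerated by program \<open>e\<close>, i.e. the range of the partial function \<open>phi e\<close>.\<close>

definition ce_set :: "nat \<Rightarrow> nat set" where
  "ce_set e = ran (phi e)"

text \<open>
  \<open>P e k\<close> reads: \<open>e\<close> is an index witnessing the property for the \<open>k\<close>-th object.
\<close>

definition uniformly :: "(nat \<Rightarrow> nat \<Rightarrow> bool) \<Rightarrow> bool" where
  "uniformly P \<longleftrightarrow> (\<exists>f. computable_fun f \<and> (\<forall>k. P (f k) k))"

section \<open>Computable reals\<close>

definition pos_rat_enum :: "nat \<Rightarrow> real" where
  "pos_rat_enum j = (case prod_decode j of (a, b) \<Rightarrow> real (Suc a) / real (Suc b))"

definition rat_enum :: "nat \<Rightarrow> real" where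
  "rat_enum j = (case prod_decode j of (a, m) \<Rightarrow> case prod_decode m of (b, c) \<Rightarrow>
     (real a - real b) / real (Suc c))"

definition computable_real_index :: "nat \<Rightarrow> real \<Rightarrow> bool" where
  "computable_real_index e r \<longleftrightarrow>
     (\<forall>k. \<exists>j. phi e k = Some j \<and> \<bar>rat_enum j - r\<bar> \<le> 1 / 2 ^ k)"

definition lower_semicomputable_index :: "nat \<Rightarrow> real \<Rightarrow> bool" where
  "lower_semicomputable_index e r \<longleftrightarrow> ce_set e = {j. rat_enum j < r}"

section \<open>Computable probability spaces and the arithmetical hierarchy\<close>

text \<open>
  The complete separable metric space is the type \<^typ>\<open>'a::polish_space\<close> with its own
  distance \<^const>\<open>dist\<close>; only the dense sequence \<open>s\<close> is additional data.
\<close>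

definition computable_metric_space :: "(nat \<Rightarrow> 'a::polish_space) \<Rightarrow> bool" where
  "computable_metric_space s \<longleftrightarrow>
     closure (range s) = UNIV \<and>
     uniformly (\<lambda>e k. case prod_decode k of (i, j) \<Rightarrow> computable_real_index e (dist (s i) (s j)))"

definition ideal_ball :: "(nat \<Rightarrow> 'a::polish_space) \<Rightarrow> nat \<Rightarrow> 'a set" where
  "ideal_ball s k = (case prod_decode k of (i, j) \<Rightarrow> {x. dist x (s i) < pos_rat_enum j})"

text \<open>\<open>Sigma0_set s n e\<close> is the \<open>e\<close>-th \<open>\<Sigma>\<^sup>0\<^sub>n\<close> set; the hierarchy starts at
  \<open>n = 1\<close> and the value at level 0 is a dummy.\<close>

fun Sigma0_set :: "(nat \<Rightarrow> 'a::polish_space) \<Rightarrow> nat \<Rightarrow> nat \<Rightarrow> 'a set" where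
  "Sigma0_set s 0 e = {}"
| "Sigma0_set s (Suc 0) e = (\<Union>i\<in>ce_set e. ideal_ball s i)"
| "Sigma0_set s (Suc (Suc n)) e = (\<Union>i\<in>ce_set e. - Sigma0_set s (Suc n) i)"

definition is_Sigma0 :: "(nat \<Rightarrow> 'a::polish_space) \<Rightarrow> nat \<Rightarrow> 'a set \<Rightarrow> bool" where
  "is_Sigma0 s n A \<longleftrightarrow> (\<exists>e. A = Sigma0_set s n e)"

definition is_Pi0 :: "(nat \<Rightarrow> 'a::polish_space) \<Rightarrow> nat \<Rightarrow> 'a set \<Rightarrow> bool" where
  "is_Pi0 s n A \<longleftrightarrow> is_Sigma0 s n (- A)"

definition Sigma0_in_index ::
  "(nat \<Rightarrow> 'a::polish_space) \<Rightarrow> nat \<Rightarrow> 'a set \<Rightarrow> nat \<Rightarrow> 'a set \<Rightarrow> bool" where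
  "Sigma0_in_index s n D e A \<longleftrightarrow> A = D \<inter> Sigma0_set s n e"

text \<open>Finite sets of naturals are given by their canonical indices via \<^const>\<open>set_decode\<close>.\<close>

definition computable_probability_space ::
  "(nat \<Rightarrow> 'a::polish_space) \<Rightarrow> 'a measure \<Rightarrow> bool" where
  "computable_probability_space s \<mu> \<longleftrightarrow>
     computable_metric_space s \<and> prob_space \<mu> \<and> sets \<mu> = sets borel \<and>
     uniformly (\<lambda>e k. lower_semicomputable_index e
                        (measure \<mu> (\<Union>i\<in>set_decode k. ideal_ball s i)))"

definition weakly_random ::
  "(nat \<Rightarrow> 'a::polish_space) \<Rightarrow> 'a measure \<Rightarrow> nat \<Rightarrow> 'a \<Rightarrow> bool" where
  "weakly_random s \<mu> n x \<longleftrightarrow> (\<forall>P. is_Pi0 s n P \<and> P \<in> null_sets \<mu> \<longrightarrow> x \<notin> P)"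

section \<open>Partial transformations\<close>

definition pvimage :: "('a \<rightharpoonup> 'a) \<Rightarrow> 'a set \<Rightarrow> 'a set" where
  "pvimage T B = {x. \<exists>y\<in>B. T x = Some y}"

primrec piterate :: "('a \<rightharpoonup> 'a) \<Rightarrow> nat \<Rightarrow> ('a \<rightharpoonup> 'a)" where
  "piterate T 0 = Some"
| "piterate T (Suc k) = T \<circ>\<^sub>m piterate T k"

text \<open>The domain of a partial Borel map is the preimage of the whole space, hence Borel.\<close>

definition measure_preserving_transformation ::
  "'a::polish_space measure \<Rightarrow> ('a \<rightharpoonup> 'a) \<Rightarrow> bool" where
  "measure_preserving_transformation \<mu> T \<longleftrightarrow>
     (\<forall>B\<in>sets borel. pvimage T B \<in> sets borel \<and> measure \<mu> (pvimage T B) = measure \<mu> B) \<and>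
     (\<forall>x\<in>dom T. the (T x) \<in> dom T)"

definition computable_transformation ::
  "(nat \<Rightarrow> 'a::polish_space) \<Rightarrow> ('a \<rightharpoonup> 'a) \<Rightarrow> bool" where
  "computable_transformation s T \<longleftrightarrow>
     uniformly (\<lambda>e i. Sigma0_in_index s 1 (dom T) e (pvimage T (ideal_ball s i)))"

definition ergodic_transformation :: "'a::polish_space measure \<Rightarrow> ('a \<rightharpoonup> 'a) \<Rightarrow> bool" where
  "ergodic_transformation \<mu> T \<longleftrightarrow>
     (\<forall>B\<in>sets borel. pvimage T B = B \<longrightarrow> measure \<mu> B = 0 \<or> measure \<mu> B = 1)"

end

(* The set of points that enter A at some time k > 0 is E = (UN k. T^-(k+1) A). It contains its own
   preimage and has at least the measure of A, so by ergodicity, applied to the intersection of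
   the iterated preimages of E, it has measure 1. Pulling back along T acts computably on indices
   of Sigma^0_n sets, so E is the intersection of dom T with a Sigma^0_n set U. The complement
   of U is a null Pi^0_n set, which x avoids. Computability on indices comes from a universal
   machine: a c.e. set is {q(e,z) | p(e,z) = 0} for fixed computable p and q. *)
theory Submission
  imports Defs
begin

section \<open>Closure properties of computable functions\<close>

abbreviation pair :: "nat \<Rightarrow> nat \<Rightarrow> nat" where
  "pair a b \<equiv> prod_encode (a, b)"

abbreviation pfst :: "nat \<Rightarrow> nat" where
  "pfst z \<equiv> fst (prod_decode z)"

abbreviation psnd :: "nat \<Rightarrow> nat" where
  "psnd z \<equiv> snd (prod_decode z)"

text \<open>Every program has a Goedel number, so the closure properties can be proved by exhibiting
  \<open>recf\<close> terms instead of indices.\<close>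

lemma computable_fun_iff: "computable_fun f \<longleftrightarrow> (\<exists>r. \<forall>x. recf_eval r x = Some (f x))"
  unfolding computable_fun_def phi_def by (metis surj_recf_of_nat surjD)

lemma computable_fun_comp:
  assumes "computable_fun f" "computable_fun g"
  shows "computable_fun (\<lambda>x. f (g x))"
proof -
  obtain r s where "\<forall>x. recf_eval r x = Some (f x)" "\<forall>x. recf_eval s x = Some (g x)"
    using assms by (auto simp: computable_fun_iff)
  then have "\<forall>x. recf_eval (RComp r s) x = Some (f (g x))" by simp
  then show ?thesis unfolding computable_fun_iff by (rule exI)
qed

lemma computable_fun_pair:
  assumes "computable_fun f" "computable_fun g"
  shows "computable_fun (\<lambda>x. pair (f x) (g x))"
proof -
  obtain r s where "\<forall>x. recf_eval r x = Some (f x)" "\<forall>x. recf_eval s x = Some (g x)"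
    using assms by (auto simp: computable_fun_iff)
  then have "\<forall>x. recf_eval (RPair r s) x = Some (pair (f x) (g x))" by simp
  then show ?thesis unfolding computable_fun_iff by (rule exI)
qed

lemma computable_fun_Suc:
  assumes "computable_fun f"
  shows "computable_fun (\<lambda>x. Suc (f x))"
  by (rule computable_fun_comp[OF _ assms]) (auto simp: computable_fun_iff intro: exI[of _ RSucc])

lemma computable_fun_pfst:
  assumes "computable_fun f"
  shows "computable_fun (\<lambda>x. pfst (f x))"
  by (rule computable_fun_comp[OF _ assms]) (auto simp: computable_fun_iff intro: exI[of _ RFst])

lemma computable_fun_psnd:
  assumes "computable_fun f"
  shows "computable_fun (\<lambda>x. psnd (f x))"
  by (rule computable_fun_comp[OF _ assms]) (auto simp: computable_fun_iff intro: exI[of _ RSnd])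

lemma computable_fun_const: "computable_fun (\<lambda>x. c)"
proof (induction c)
  case 0
  show ?case by (auto simp: computable_fun_iff intro: exI[of _ RZero])
qed (rule computable_fun_Suc)

text \<open>The identity is not an initial function; splitting a number and pairing the halves again
  yields it.\<close>

lemma computable_fun_id: "computable_fun (\<lambda>x. x)"
  by (auto simp: computable_fun_iff intro!: exI[of _ "RPair RFst RSnd"])

lemma computable_fun_rec:
  assumes "computable_fun f" "computable_fun g" "computable_fun h"
  shows "computable_fun (\<lambda>x. rec_nat (g x) (\<lambda>m v. h (pair x (pair m v))) (f x))"
proof -
  obtain r s t where "\<forall>x. recf_eval r x = Some (f x)"
    and s: "\<forall>x. recf_eval s x = Some (g x)" and t: "\<forall>x. recf_eval t x = Some (h x)"
    using assms by (auto simp: computable_fun_iff)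
  moreover have "recf_eval (RPrec s t) (pair x n)
      = Some (rec_nat (g x) (\<lambda>m v. h (pair x (pair m v))) n)" for x n
    by (induction n) (use s t in auto)
  ultimately have "\<forall>x. recf_eval (RComp (RPrec s t) (RPair (RPair RFst RSnd) r)) x
      = Some (rec_nat (g x) (\<lambda>m v. h (pair x (pair m v))) (f x))"
    by simp
  then show ?thesis unfolding computable_fun_iff by (rule exI)
qed

lemma computable_fun_funpow:
  assumes f: "computable_fun f" and "computable_fun g" "computable_fun h"
  shows "computable_fun (\<lambda>x. (f ^^ g x) (h x))"
proof -
  have "computable_fun (\<lambda>z. f (psnd (psnd z)))"
    by (intro computable_fun_comp[OF f] computable_fun_psnd computable_fun_id)
  from computable_fun_rec[OF assms(2,3) this]
  have "computable_fun (\<lambda>x. rec_nat (h x) (\<lambda>m. f) (g x))" by simp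
  moreover have "rec_nat a (\<lambda>m. f) n = (f ^^ n) a" for a n
    by (induction n) auto
  ultimately show ?thesis by simp
qed

lemma computable_fun_diff_const:
  assumes "computable_fun f"
  shows "computable_fun (\<lambda>x. f x - c)"
proof -
  have "computable_fun (\<lambda>z. pfst (psnd z))"
    by (intro computable_fun_pfst computable_fun_psnd computable_fun_id)
  \<comment> \<open>The recursion forgets its previous value and returns the stage, so it ends with
    the predecessor.\<close>
  from computable_fun_rec[OF computable_fun_id computable_fun_const[of 0] this]
  have "computable_fun (\<lambda>x. rec_nat 0 (\<lambda>m v. m) x)" by simp
  moreover have "rec_nat 0 (\<lambda>m v. m) x = x - 1" for x :: nat
    by (cases x) auto
  ultimately have "computable_fun (\<lambda>x. x - 1)" by simp
  from computable_fun_funpow[OF this computable_fun_const[of c] assms]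
  have "computable_fun (\<lambda>x. ((\<lambda>y. y - 1) ^^ c) (f x))" .
  moreover have "((\<lambda>y. y - 1) ^^ c) x = x - c" for x :: nat
    by (induction c) auto
  ultimately show ?thesis by simp
qed

text \<open>Recursion along \<open>f x - c\<close>: no round leaves \<open>g x\<close>, and any
  positive number of rounds overwrites it with \<open>h x\<close>. All tests of the machine below
  are written in the form \<open>_ <= c\<close> to fit this rule.\<close>

lemma computable_fun_if_le:
  assumes "computable_fun f" "computable_fun g" "computable_fun h"
  shows "computable_fun (\<lambda>x. if f x \<le> c then g x else h x)"
proof -
  have "computable_fun (\<lambda>z. h (pfst z))"
    by (intro computable_fun_comp[OF assms(3)] computable_fun_pfst computable_fun_id)
  from computable_fun_rec[OF computable_fun_diff_const[OF assms(1), of c] assms(2) this]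
  have "computable_fun (\<lambda>x. rec_nat (g x) (\<lambda>m v. h x) (f x - c))" by simp
  moreover have "rec_nat (g x) (\<lambda>m v. h x) (f x - c) = (if f x \<le> c then g x else h x)" for x
    by (cases "f x - c") auto
  ultimately show ?thesis by simp
qed

lemmas computable_fun_intros =
  computable_fun_const computable_fun_id computable_fun_Suc computable_fun_pfst
  computable_fun_psnd computable_fun_pair computable_fun_diff_const computable_fun_if_le

section \<open>An abstract machine for recursive functions\<close>

text \<open>A frame is the work pending on the value of a subcomputation, with programs given by
  Goedel numbers. In \<open>FPrec g a m d\<close> the awaited value belongs to stage
  \<open>m\<close>, and \<open>d\<close> rounds remain; in \<open>FMu f x n\<close> the candidate
  under test is \<open>n\<close>.\<close>

datatype frame =
    FPairL nat nat | FPairR nat | FComp nat | FPrec nat nat nat nat | FMu nat nat nat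

datatype config = Eval nat nat "frame list" | Return nat "frame list"

fun return_step :: "nat \<Rightarrow> frame \<Rightarrow> frame list \<Rightarrow> config" where
  "return_step v (FPairL g x) K = Eval g x (FPairR v # K)"
| "return_step v (FPairR a) K = Return (pair a v) K"
| "return_step v (FComp f) K = Eval f v K"
| "return_step v (FPrec g a m d) K =
     (if d \<le> 0 then Return v K
      else Eval g (pair a (pair m v)) (FPrec g a (Suc m) (d - 1) # K))"
| "return_step v (FMu f x n) K =
     (if v \<le> 0 then Return n K else Eval f (pair x (Suc n)) (FMu f x (Suc n) # K))"

text \<open>Halting is represented by the fixed points \<open>Return v []\<close>, which keeps
  \<open>step\<close> total.\<close>

fun step :: "config \<Rightarrow> config" where
  "step (Return v []) = Return v []"
| "step (Return v (F # K)) = return_step v F K"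
| "step (Eval e x K) =
     (let t = pfst e; r = psnd e; a = pfst r; b = psnd r in
      if t \<le> 0 then Return 0 K
      else if t \<le> 1 then Return (Suc x) K
      else if t \<le> 2 then Return (pfst x) K
      else if t \<le> 3 then Return (psnd x) K
      else if t \<le> 4 then Eval a x (FPairL b x # K)
      else if t \<le> 5 then Eval b x (FComp a # K)
      else if t \<le> 6 then Eval a (pfst x) (FPrec b (pfst x) 0 (psnd x) # K)
      else Eval r (pair x 0) (FMu r x 0 # K))"

section \<open>Searches and recursions resumed midway\<close>

definition mu_from :: "(nat \<Rightarrow> nat option) \<Rightarrow> nat \<Rightarrow> nat option" where
  "mu_from F n =
     (if \<exists>k\<ge>n. F k = Some 0 \<and> (\<forall>m. n \<le> m \<and> m < k \<longrightarrow> (\<exists>j. F m = Some (Suc j)))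
      then Some (LEAST k. n \<le> k \<and> F k = Some 0) else None)"

lemma recf_eval_RMu: "recf_eval (RMu f) x = mu_from (\<lambda>n. recf_eval f (pair x n)) 0"
  by (simp add: mu_from_def)

lemma mu_from_unfold:
  "mu_from F n = Option.bind (F n) (\<lambda>v. if v \<le> 0 then Some n else mu_from F (Suc n))"
proof (cases "F n")
  case None
  then have "\<not> (\<exists>k\<ge>n. F k = Some 0 \<and> (\<forall>m. n \<le> m \<and> m < k \<longrightarrow> (\<exists>j. F m = Some (Suc j))))"
    by (metis le_neq_implies_less option.distinct(1) order_refl)
  with None show ?thesis by (simp add: mu_from_def)
next
  case (Some v)
  show ?thesis
  proof (cases v)
    case 0
    then have "(LEAST k. n \<le> k \<and> F k = Some 0) = n"
      by (intro Least_equality) (use Some in auto)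
    moreover have "\<exists>k\<ge>n. F k = Some 0 \<and> (\<forall>m. n \<le> m \<and> m < k \<longrightarrow> (\<exists>j. F m = Some (Suc j)))"
      by (rule exI[of _ n]) (use Some 0 in auto)
    ultimately show ?thesis using Some 0 by (simp add: mu_from_def)
  next
    case (Suc j)
    have 1: "n \<le> k \<and> F k = Some 0 \<longleftrightarrow> Suc n \<le> k \<and> F k = Some 0" for k
      using Some Suc by (cases "k = n") auto
    have 2: "(\<forall>m. n \<le> m \<and> m < k \<longrightarrow> (\<exists>j. F m = Some (Suc j))) \<longleftrightarrow>
        (\<forall>m. Suc n \<le> m \<and> m < k \<longrightarrow> (\<exists>j. F m = Some (Suc j)))" for k
      using Some Suc by (metis Suc_leD Suc_leI le_neq_implies_less)
    have "mu_from F n = mu_from F (Suc n)"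
      by (simp only: mu_from_def 2 conj_assoc[symmetric] 1)
    then show ?thesis using Some Suc by simp
  qed
qed

text \<open>The last \<open>d\<close> rounds of a primitive recursion, as a function of the value at
  stage \<open>m\<close>. Like the machine, it peels off the first round, whereas
  \<open>RPrec\<close> peels off the last.\<close>

primrec prec_from :: "(nat \<Rightarrow> nat option) \<Rightarrow> nat \<Rightarrow> nat \<Rightarrow> nat \<Rightarrow> (nat \<Rightarrow> nat option)" where
  "prec_from G a 0 m = Some"
| "prec_from G a (Suc d) m =
     (\<lambda>v. Option.bind (G (pair a (pair m v))) (prec_from G a d (Suc m)))"

lemma recf_eval_RPrec:
  "recf_eval (RPrec f g) x =
     Option.bind (recf_eval f (pfst x)) (prec_from (recf_eval g) (pfst x) (psnd x) 0)"
proof -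
  define a where "a = pfst x"
  define R where "R = rec_nat (recf_eval f a)
         (\<lambda>m r. Option.bind r (\<lambda>v. recf_eval g (pair a (pair m v))))"
  \<comment> \<open>Generalised over the stage reached: \<open>d\<close> further rounds lead from
    stage \<open>m\<close> to stage \<open>m + d\<close>.\<close>
  have "Option.bind (R m) (prec_from (recf_eval g) a d m) = R (m + d)" for m d
  proof (induction d arbitrary: m)
    case 0
    show ?case by simp
  next
    case (Suc d)
    have "Option.bind (R m) (prec_from (recf_eval g) a (Suc d) m)
        = Option.bind (R (Suc m)) (prec_from (recf_eval g) a d (Suc m))"
      by (simp add: R_def)
    with Suc[of "Suc m"] show ?case by simp
  qed
  from this[of 0 "psnd x"] show ?thesis
    by (simp add: R_def a_def split_beta)
qed

text \<open>The value that a configuration will eventually return. It is invariant under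
  \<open>step\<close>, which yields soundness of the machine.\<close>

fun frame_value :: "frame \<Rightarrow> nat \<Rightarrow> nat option" where
  "frame_value (FPairL g x) v = Option.bind (phi g x) (\<lambda>b. Some (pair v b))"
| "frame_value (FPairR a) v = Some (pair a v)"
| "frame_value (FComp f) v = phi f v"
| "frame_value (FPrec g a m d) v = prec_from (phi g) a d m v"
| "frame_value (FMu f x n) v =
     (if v \<le> 0 then Some n else mu_from (\<lambda>n. phi f (pair x n)) (Suc n))"

primrec stack_value :: "frame list \<Rightarrow> nat \<Rightarrow> nat option" where
  "stack_value [] = Some"
| "stack_value (F # K) = (\<lambda>v. Option.bind (frame_value F v) (stack_value K))"

primrec config_value :: "config \<Rightarrow> nat option" where
  "config_value (Eval e x K) = Option.bind (phi e x) (stack_value K)"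
| "config_value (Return v K) = stack_value K v"

text \<open>The case split on the tag mirrors \<open>step\<close>, so that the two can be compared
  branch by branch.\<close>

lemma phi_unfold:
  "phi e x =
     (let t = pfst e; r = psnd e; a = pfst r; b = psnd r in
      if t \<le> 0 then Some 0
      else if t \<le> 1 then Some (Suc x)
      else if t \<le> 2 then Some (pfst x)
      else if t \<le> 3 then Some (psnd x)
      else if t \<le> 4 then Option.bind (phi a x) (\<lambda>u. Option.bind (phi b x) (\<lambda>v. Some (pair u v)))
      else if t \<le> 5 then Option.bind (phi b x) (phi a)
      else if t \<le> 6 then Option.bind (phi a (pfst x)) (prec_from (phi b) (pfst x) (psnd x) 0)
      else mu_from (\<lambda>n. phi r (pair x n)) 0)"
  unfolding phi_def
  by (subst recf_of_nat.simps)
     (simp add: split_beta Let_def recf_eval_RMu recf_eval_RPrec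
       del: recf_eval.simps(7,8))

lemma config_value_step: "config_value (step c) = config_value c"
proof (cases c)
  case (Eval e x K)
  show ?thesis
    unfolding Eval config_value.simps phi_unfold[of e x]
    by (simp add: Let_def mu_from_unfold[of _ 0])
next
  case (Return v K)
  show ?thesis
  proof (cases K)
    case (Cons F K')
    show ?thesis
    proof (cases F)
      case (FPrec g a m d)
      then show ?thesis using Return Cons by (cases d) auto
    next
      case (FMu f y n)
      then show ?thesis
        using Return Cons by (simp add: mu_from_unfold[of _ "Suc n"])
    qed (use Return Cons in auto)
  qed (use Return in auto)
qed

section \<open>Completeness of the machine\<close>

definition reaches :: "config \<Rightarrow> config \<Rightarrow> bool" where
  "reaches c c' \<longleftrightarrow> (\<exists>t. (step ^^ t) c = c')"

lemma reaches_refl: "reaches c c"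
  unfolding reaches_def by (rule exI[of _ 0]) simp

lemma reaches_trans:
  assumes "reaches c c'" "reaches c' c''"
  shows "reaches c c''"
  using assms unfolding reaches_def by (metis comp_apply funpow_add)

lemma reaches_step: "reaches (step c) c' \<Longrightarrow> reaches c c'"
  unfolding reaches_def by (metis comp_apply funpow_Suc_right)

text \<open>Completeness for the body \<open>g\<close> is a premise here, to be supplied by the
  induction on indices in \<open>reaches_complete\<close>.\<close>

lemma reaches_prec:
  assumes "\<And>z y K. phi g z = Some y \<Longrightarrow> reaches (Eval g z K) (Return y K)"
    and "prec_from (phi g) a d m v = Some y"
  shows "reaches (Return v (FPrec g a m d # K)) (Return y K)"
  using assms(2)
proof (induction d arbitrary: m v)
  case 0
  show ?case by (rule reaches_step) (use 0 in \<open>simp add: reaches_refl\<close>)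
next
  case (Suc d)
  then obtain w where w: "phi g (pair a (pair m v)) = Some w"
    and "prec_from (phi g) a d (Suc m) w = Some y"
    by (auto simp: bind_eq_Some_conv)
  with Suc.IH have "reaches (Return w (FPrec g a (Suc m) d # K)) (Return y K)" by blast
  then have "reaches (step (Return v (FPrec g a m (Suc d) # K))) (Return y K)"
    by (simp add: reaches_trans[OF assms(1)[OF w]])
  then show ?case by (rule reaches_step)
qed

lemma reaches_mu:
  assumes "\<And>z y K. phi f z = Some y \<Longrightarrow> reaches (Eval f z K) (Return y K)"
    and "phi f (pair x k) = Some 0" "n \<le> k"
    and "\<And>m. n \<le> m \<Longrightarrow> m < k \<Longrightarrow> \<exists>j. phi f (pair x m) = Some (Suc j)"
  shows "reaches (Eval f (pair x n) (FMu f x n # K)) (Return k K)"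
  using assms(3,4)
\<comment> \<open>Downward induction from the zero at \<open>k\<close> to the starting
  candidate.\<close>
proof (induction n rule: inc_induct)
  case base
  show ?case
    by (rule reaches_trans[OF assms(1)[OF assms(2)]], rule reaches_step)
       (simp add: reaches_refl)
next
  case (step n)
  then obtain j where j: "phi f (pair x n) = Some (Suc j)" by blast
  show ?case
    by (rule reaches_trans[OF assms(1)[OF j]], rule reaches_step) (use step in simp)
qed

text \<open>The value is defined as the least zero. It is the witness of termination, because all
  values before that witness are positive.\<close>

lemma mu_from_0_SomeD:
  assumes "mu_from F 0 = Some k"
  shows "F k = Some 0" "\<And>m. m < k \<Longrightarrow> \<exists>j. F m = Some (Suc j)"
proof -
  obtain l where l: "F l = Some 0" "\<forall>m<l. \<exists>j. F m = Some (Suc j)"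
    using assms by (auto simp: mu_from_def split: if_splits)
  have "(LEAST k. F k = Some 0) = l"
  proof (rule Least_equality)
    show "l \<le> m" if "F m = Some 0" for m
      using l(2) that by (cases "m < l") auto
  qed (rule l(1))
  then have "k = l"
    using assms by (auto simp: mu_from_def split: if_splits)
  with l show "F k = Some 0" "\<And>m. m < k \<Longrightarrow> \<exists>j. F m = Some (Suc j)" by auto
qed

text \<open>Strong induction on the index, whose components are smaller when the tag is positive.
  The stack is arbitrary, so that subprograms can run on top of pending frames.\<close>

lemma reaches_complete:
  assumes "phi e x = Some y"
  shows "reaches (Eval e x K) (Return y K)"
  using assms
proof (induction e arbitrary: x y K rule: less_induct)
  case (less e)
  define t r where "t = pfst e" and "r = psnd e"
  define a b where "a = pfst r" and "b = psnd r"
  note defs = t_def[symmetric] r_def[symmetric] a_def[symmetric] b_def[symmetric]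
  have lt: "r < e" "a < e" "b < e" if "0 < t"
  proof -
    show "r < e" using prod_decode_snd_less[of t r e] that by (simp add: t_def r_def)
    then show "a < e" "b < e"
      using prod_decode_fst_le[of r] prod_decode_snd_le[of r] by (auto simp: a_def b_def)
  qed
  note phi_e = less.prems[unfolded phi_unfold[of e x] Let_def defs]
  \<comment> \<open>Every tag from 7 on codes a search, and its body is all of
    \<open>r\<close>.\<close>
  consider "t \<le> 3" | "t = 4" | "t = 5" | "t = 6" | "t \<ge> 7" by linarith
  then show ?case
  proof cases
    case 1
    show ?thesis
      by (rule reaches_step)
         (use 1 phi_e in \<open>auto simp: Let_def defs reaches_refl split: if_splits\<close>)
  next
    case 2
    with phi_e obtain u v where u: "phi a x = Some u" and v: "phi b x = Some v" "y = pair u v"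
      by (auto simp: bind_eq_Some_conv)
    have "reaches (Eval a x (FPairL b x # K)) (Return u (FPairL b x # K))"
      using less.IH[OF lt(2) u] 2 by simp
    moreover have "reaches (Return u (FPairL b x # K)) (Return v (FPairR u # K))"
      by (rule reaches_step) (use less.IH[OF lt(3) v(1)] 2 in simp)
    moreover have "reaches (Return v (FPairR u # K)) (Return y K)"
      by (rule reaches_step) (use v in \<open>simp add: reaches_refl\<close>)
    ultimately have "reaches (Eval a x (FPairL b x # K)) (Return y K)"
      by (meson reaches_trans)
    then have "reaches (step (Eval e x K)) (Return y K)"
      using 2 by (simp add: Let_def defs)
    then show ?thesis by (rule reaches_step)
  next
    case 3
    with phi_e obtain u where u: "phi b x = Some u" and v: "phi a u = Some y"
      by (auto simp: bind_eq_Some_conv)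
    have "reaches (Eval b x (FComp a # K)) (Return u (FComp a # K))"
      using less.IH[OF lt(3) u] 3 by simp
    moreover have "reaches (Return u (FComp a # K)) (Return y K)"
      by (rule reaches_step) (use less.IH[OF lt(2) v(1)] 3 in simp)
    ultimately have "reaches (Eval b x (FComp a # K)) (Return y K)"
      by (meson reaches_trans)
    then have "reaches (step (Eval e x K)) (Return y K)"
      using 3 by (simp add: Let_def defs)
    then show ?thesis by (rule reaches_step)
  next
    case 4
    with phi_e obtain u where u: "phi a (pfst x) = Some u"
      and v: "prec_from (phi b) (pfst x) (psnd x) 0 u = Some y"
      by (auto simp: bind_eq_Some_conv)
    let ?F = "FPrec b (pfst x) 0 (psnd x)"
    have "reaches (Eval a (pfst x) (?F # K)) (Return u (?F # K))"
      using less.IH[OF lt(2) u] 4 by simp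
    moreover have "reaches (Return u (?F # K)) (Return y K)"
      by (rule reaches_prec[OF _ v]) (use less.IH[OF lt(3)] 4 in simp)
    ultimately have "reaches (Eval a (pfst x) (?F # K)) (Return y K)"
      by (meson reaches_trans)
    then have "reaches (step (Eval e x K)) (Return y K)"
      using 4 by (simp add: Let_def defs)
    then show ?thesis by (rule reaches_step)
  next
    case 5
    with phi_e have "mu_from (\<lambda>n. phi r (pair x n)) 0 = Some y" by simp
    note mu = mu_from_0_SomeD[OF this]
    have "reaches (Eval r (pair x 0) (FMu r x 0 # K)) (Return y K)"
      by (rule reaches_mu[OF _ mu(1) le0 mu(2)]) (use less.IH[OF lt(1)] 5 in simp_all)
    then have "reaches (step (Eval e x K)) (Return y K)"
      using 5 by (simp add: Let_def defs)
    then show ?thesis by (rule reaches_step)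
  qed
qed

text \<open>Soundness holds because \<open>config_value\<close> is constant along a run: it is
  \<open>phi e x\<close> at the start and \<open>Some y\<close> at the end.\<close>

lemma phi_iff_reaches: "phi e x = Some y \<longleftrightarrow> reaches (Eval e x []) (Return y [])"
proof
  assume "reaches (Eval e x []) (Return y [])"
  then obtain t where t: "(step ^^ t) (Eval e x []) = Return y []"
    by (auto simp: reaches_def)
  have "config_value ((step ^^ t) c) = config_value c" for c
    by (induction t) (auto simp: config_value_step)
  from this[of "Eval e x []"] show "phi e x = Some y"
    using t by (cases "phi e x") auto
qed (rule reaches_complete)

section \<open>The Kleene normal form for c.e. sets\<close>

text \<open>Tag 0 is the empty stack, and \<open>pair 0 0 = 0\<close>.\<close>

primrec stack_code :: "frame list \<Rightarrow> nat" where
  "stack_code [] = 0"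
| "stack_code (F # K) = (case F of
      FPairL g x \<Rightarrow> pair 1 (pair (pair g x) (stack_code K))
    | FPairR a \<Rightarrow> pair 2 (pair a (stack_code K))
    | FComp f \<Rightarrow> pair 3 (pair f (stack_code K))
    | FPrec g a m d \<Rightarrow> pair 4 (pair (pair (pair g a) (pair m d)) (stack_code K))
    | FMu f x n \<Rightarrow> pair 5 (pair (pair f (pair x n)) (stack_code K)))"

definition eval_code :: "nat \<Rightarrow> nat \<Rightarrow> nat \<Rightarrow> nat" where
  "eval_code e x k = pair 0 (pair (pair e x) k)"

definition return_code :: "nat \<Rightarrow> nat \<Rightarrow> nat" where
  "return_code v k = pair 1 (pair v k)"

primrec config_code :: "config \<Rightarrow> nat" where
  "config_code (Eval e x K) = eval_code e x (stack_code K)"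
| "config_code (Return v K) = return_code v (stack_code K)"

text \<open>The tags 1, 3, 4 and 5 pushed here are those of \<open>stack_code\<close>; the input is
  read as \<open>pair 0 (pair (pair e x) k)\<close>.\<close>

definition eval_step_code :: "nat \<Rightarrow> nat" where
  "eval_step_code c =
     (let e = pfst (pfst (psnd c)); x = psnd (pfst (psnd c)); k = psnd (psnd c);
          t = pfst e; r = psnd e; a = pfst r; b = psnd r in
      if t \<le> 0 then return_code 0 k
      else if t \<le> 1 then return_code (Suc x) k
      else if t \<le> 2 then return_code (pfst x) k
      else if t \<le> 3 then return_code (psnd x) k
      else if t \<le> 4 then eval_code a x (pair 1 (pair (pair b x) k))
      else if t \<le> 5 then eval_code b x (pair 3 (pair a k))
      else if t \<le> 6 then
        eval_code a (pfst x) (pair 4 (pair (pair (pair b (pfst x)) (pair 0 (psnd x))) k))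
      else eval_code r (pair x 0) (pair 5 (pair (pair r (pair x 0)) k)))"

definition return_step_code :: "nat \<Rightarrow> nat" where
  "return_step_code c =
     (let v = pfst (psnd c); l = psnd (psnd c);
          t = pfst l; F = pfst (psnd l); k = psnd (psnd l) in
      if t \<le> 0 then c
      else if t \<le> 1 then eval_code (pfst F) (psnd F) (pair 2 (pair v k))
      else if t \<le> 2 then return_code (pair F v) k
      else if t \<le> 3 then eval_code F v k
      else if t \<le> 4 then
        (if psnd (psnd F) \<le> 0 then return_code v k
         else eval_code (pfst (pfst F)) (pair (psnd (pfst F)) (pair (pfst (psnd F)) v))
           (pair 4 (pair (pair (pfst F)
              (pair (Suc (pfst (psnd F))) (psnd (psnd F) - 1))) k)))
      else
        (if v \<le> 0 then return_code (psnd (psnd F)) k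
         else eval_code (pfst F) (pair (pfst (psnd F)) (Suc (psnd (psnd F))))
           (pair 5 (pair (pair (pfst F) (pair (pfst (psnd F)) (Suc (psnd (psnd F))))) k))))"

definition step_code :: "nat \<Rightarrow> nat" where
  "step_code c = (if pfst c \<le> 0 then eval_step_code c else return_step_code c)"

lemma pfst_0: "pfst 0 = 0"
  using prod_decode_fst_le[of 0] by simp

lemma step_code_config: "step_code (config_code c) = config_code (step c)"
proof (cases c)
  case (Eval e x K)
  then show ?thesis
    by (simp add: step_code_def eval_step_code_def Let_def)
       (simp add: eval_code_def return_code_def Let_def)
next
  case (Return v K)
  show ?thesis
  proof (cases K)
    case Nil
    then show ?thesis using Return
      by (simp add: step_code_def return_step_code_def return_code_def Let_def pfst_0)
  next
    case (Cons F K')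
    show ?thesis
      by (cases F) (use Return Cons in \<open>simp_all add: step_code_def return_step_code_def
        eval_code_def return_code_def Let_def\<close>)
  qed
qed

lemma computable_fun_step_code: "computable_fun step_code"
  unfolding step_code_def eval_step_code_def return_step_code_def eval_code_def return_code_def
    Let_def
  by (intro computable_fun_intros)

text \<open>The number \<open>z\<close> codes an input together with a number of steps;
  \<open>p\<close> tests whether the run has halted by then, and \<open>q\<close> reads off the
  result.\<close>

lemma ce_set_normal_form:
  obtains p q where "computable_fun p" "computable_fun q"
    and "\<And>e. ce_set e = {q (pair e z) | z. p (pair e z) = 0}"
proof
  define run where "run w = (step_code ^^ psnd (psnd w))
    (eval_code (pfst w) (pfst (psnd w)) 0)" for w
  \<comment> \<open>An \<open>Eval\<close> state gets the value 1; a \<open>Return\<close> state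
    gets the tag of its stack, which is 0 exactly for the empty stack.\<close>
  define p where "p w = (if pfst (run w) \<le> 0 then 1 else pfst (psnd (psnd (run w))))" for w
  define q where "q w = pfst (psnd (run w))" for w
  have run: "computable_fun run"
    unfolding run_def eval_code_def
    by (intro computable_fun_funpow[OF computable_fun_step_code] computable_fun_intros)
  show "computable_fun p" "computable_fun q"
    unfolding p_def q_def by (intro computable_fun_intros run)+
  have run_eq: "run (pair e (pair x t)) = config_code ((step ^^ t) (Eval e x []))" for e x t
  proof -
    have "(step_code ^^ t) (config_code c) = config_code ((step ^^ t) c)" for c
      by (induction t) (auto simp: step_code_config)
    from this[of "Eval e x []"] show ?thesis by (simp add: run_def)
  qed
  have halt: "p (pair e (pair x t)) = 0 \<and> q (pair e (pair x t)) = y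
      \<longleftrightarrow> (step ^^ t) (Eval e x []) = Return y []" for e x t y
  proof (cases "(step ^^ t) (Eval e x [])")
    case (Eval e' x' K)
    then show ?thesis by (simp add: p_def run_eq eval_code_def)
  next
    case (Return v K)
    then show ?thesis
      by (cases K) (auto simp: p_def q_def run_eq return_code_def pfst_0 split: frame.splits)
  qed
  show "ce_set e = {q (pair e z) | z. p (pair e z) = 0}" for e
  proof (intro set_eqI)
    fix y
    have "y \<in> ce_set e \<longleftrightarrow> (\<exists>x t. (step ^^ t) (Eval e x []) = Return y [])"
      by (simp add: ce_set_def ran_def phi_iff_reaches reaches_def)
    also have "\<dots> \<longleftrightarrow> (\<exists>x t. p (pair e (pair x t)) = 0 \<and> q (pair e (pair x t)) = y)"
      by (simp add: halt)
    also have "\<dots> \<longleftrightarrow> (\<exists>z. p (pair e z) = 0 \<and> q (pair e z) = y)"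
      by (metis prod.collapse prod_decode_inverse)
    finally show "y \<in> ce_set e \<longleftrightarrow> y \<in> {q (pair e z) | z. p (pair e z) = 0}" by auto
  qed
qed

section \<open>Computing indices of c.e. sets\<close>

lemma phi_code_simps:
  "phi (pair 0 0) x = Some 0"
  "phi (pair (Suc 0) 0) x = Some (Suc x)"
  "phi (pair 2 0) x = Some (pfst x)"
  "phi (pair 3 0) x = Some (psnd x)"
  "phi (pair 4 (pair f g)) x
     = Option.bind (phi f x) (\<lambda>u. Option.bind (phi g x) (\<lambda>v. Some (pair u v)))"
  "phi (pair 5 (pair f g)) x = Option.bind (phi g x) (phi f)"
  by (subst phi_unfold, simp add: Let_def)+

text \<open>The converse of the normal form, by an s-m-n argument: \<open>h e\<close> hard-wires
  \<open>e\<close> into a fixed program \<open>R\<close> that diverges where \<open>p\<close> is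
  nonzero.\<close>

lemma uniform_ce_set:
  assumes "computable_fun p" "computable_fun q"
  obtains h where "computable_fun h"
    and "\<And>e. ce_set (h e) = {q (pair e z) | z. p (pair e z) = 0}"
proof -
  obtain P where P: "\<And>x. recf_eval P x = Some (p x)"
    using assms by (auto simp: computable_fun_iff)
  obtain Q where Q: "\<And>x. recf_eval Q x = Some (q x)"
    using assms by (auto simp: computable_fun_iff)
  \<comment> \<open>The search ignores its counter: it stops at once if \<open>p w = 0\<close> and
    never otherwise. \<open>RFst\<close> then keeps only the value of \<open>Q\<close>.\<close>
  define R where "R = RComp RFst (RPair Q (RMu (RComp P RFst)))"
  have R: "recf_eval R w = (if p w = 0 then Some (q w) else None)" for w
    by (auto simp: R_def P Q)
  obtain r where r: "recf_of_nat r = R"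
    using surj_recf_of_nat by (metis surjD)
  \<comment> \<open>The constant program for \<open>e\<close>: the successor composed
    \<open>e\<close> times onto zero.\<close>
  define c where "c e = ((\<lambda>k. pair 5 (pair (pair (Suc 0) 0) k)) ^^ e) (pair 0 0)" for e
  have c: "phi (c e) x = Some e" for e x
    by (induction e) (auto simp: c_def phi_code_simps)
  \<comment> \<open>In terms: \<open>R\<close> after the pair of the constant \<open>e\<close> and
    the identity, the latter again as the pair of both projections.\<close>
  define h where
    "h e = pair 5 (pair r (pair 4 (pair (c e) (pair 4 (pair (pair 2 0) (pair 3 0))))))" for e
  have "computable_fun c"
    unfolding c_def by (intro computable_fun_funpow computable_fun_intros)
  then have "computable_fun h"
    unfolding h_def by (intro computable_fun_intros)
  moreover have "phi (h e) z = (if p (pair e z) = 0 then Some (q (pair e z)) else None)" for e z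
    by (simp add: h_def phi_code_simps c) (simp add: phi_def r R)
  then have "ce_set (h e) = {q (pair e z) | z. p (pair e z) = 0}" for e
    by (auto simp: ce_set_def ran_def split: if_splits)
  ultimately show ?thesis by (rule that)
qed

lemma ce_set_image:
  assumes f: "computable_fun f"
  obtains h where "computable_fun h" "\<And>e. ce_set (h e) = f ` ce_set e"
proof -
  obtain p q where pq: "computable_fun p" "computable_fun q"
    and ce: "\<And>e. ce_set e = {q (pair e z) | z. p (pair e z) = 0}"
    using ce_set_normal_form by blast
  obtain h where "computable_fun h"
    and "\<And>e. ce_set (h e) = {f (q (pair e z)) | z. p (pair e z) = 0}"
    by (rule uniform_ce_set[OF pq(1) computable_fun_comp[OF f pq(2)]]) blast
  then show ?thesis by (intro that[of h]) (auto simp: ce)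
qed

text \<open>A witness for the union is a pair: a run listing some \<open>i\<close>, and a run
  listing an element of the set with index \<open>f i\<close>. These are \<open>left\<close> and
  \<open>right\<close> below.\<close>

lemma ce_set_Union:
  assumes f: "computable_fun f"
  obtains h where "computable_fun h" "\<And>e. ce_set (h e) = (\<Union>i\<in>ce_set e. ce_set (f i))"
proof -
  obtain p q where p: "computable_fun p" and q: "computable_fun q"
    and ce: "\<And>e. ce_set e = {q (pair e z) | z. p (pair e z) = 0}"
    using ce_set_normal_form by blast
  define left where "left w = pair (pfst w) (pfst (psnd w))" for w
  define right where "right w = pair (f (q (left w))) (psnd (psnd w))" for w
  have left: "computable_fun left"
    unfolding left_def by (intro computable_fun_intros)
  have right: "computable_fun right"
    unfolding right_def
    by (intro computable_fun_intros computable_fun_comp[OF f] computable_fun_comp[OF q] left)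
  have cp: "computable_fun (\<lambda>w. if p (left w) \<le> 0 then p (right w) else 1)"
    by (intro computable_fun_intros computable_fun_comp[OF p] left right)
  have cq: "computable_fun (\<lambda>w. q (right w))"
    by (intro computable_fun_comp[OF q] right)
  obtain h where "computable_fun h" and h: "\<And>e. ce_set (h e) =
      {q (right (pair e z)) | z. (if p (left (pair e z)) \<le> 0 then p (right (pair e z)) else 1) = 0}"
    by (rule uniform_ce_set[OF cp cq]) blast
  have "ce_set (h e) = (\<Union>i\<in>ce_set e. ce_set (f i))" for e
  proof (intro set_eqI iffI)
    fix y assume "y \<in> ce_set (h e)"
    then obtain z where "y = q (right (pair e z))" "p (left (pair e z)) = 0"
      "p (right (pair e z)) = 0"
      by (auto simp: h split: if_splits)
    then show "y \<in> (\<Union>i\<in>ce_set e. ce_set (f i))"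
      by (auto simp: ce left_def right_def)
  next
    fix y assume "y \<in> (\<Union>i\<in>ce_set e. ce_set (f i))"
    then obtain z z' where "p (pair e z) = 0" "p (pair (f (q (pair e z))) z') = 0"
      "y = q (pair (f (q (pair e z))) z')"
      by (auto simp: ce)
    then show "y \<in> ce_set (h e)"
      by (auto simp: h left_def right_def intro!: exI[of _ "pair z z'"])
  qed
  then show ?thesis by (rule that[OF \<open>computable_fun h\<close>])
qed

lemma ce_set_iterates:
  assumes g: "computable_fun g"
  obtains e' where "ce_set e' = (\<Union>k. ce_set ((g ^^ Suc k) e))"
proof -
  have iter: "computable_fun (\<lambda>k. (g ^^ Suc k) e)"
    by (intro computable_fun_funpow[OF g] computable_fun_intros)
  obtain h where h: "\<And>i. ce_set (h i) = (\<Union>k\<in>ce_set i. ce_set ((g ^^ Suc k) e))"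
    by (rule ce_set_Union[OF iter]) blast
  \<comment> \<open>The range of the identity serves as an index of all naturals, over which the
    union is taken.\<close>
  obtain i where "\<And>x. phi i x = Some x"
    using computable_fun_id by (auto simp: computable_fun_def)
  then have "ce_set i = UNIV"
    by (auto simp: ce_set_def ran_def)
  with h[of i] show ?thesis by (intro that[of "h i"]) simp
qed

section \<open>Preimages of effective Borel sets\<close>

lemma sets_Sigma0_set: "Sigma0_set s n e \<in> sets borel"
proof (induction s n e rule: Sigma0_set.induct)
  case (2 s e)
  have "open (ideal_ball s i)" for i
    unfolding ideal_ball_def by (auto simp: split_beta intro!: open_Collect_less continuous_intros)
  then show ?case by auto
next
  case (3 s n e)
  then show ?case by (auto intro!: sets.countable_UN'' borel_comp simp del: Sigma0_set.simps(1,2))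
qed simp

lemma pvimage_UN: "pvimage T (\<Union>i\<in>I. B i) = (\<Union>i\<in>I. pvimage T (B i))"
  by (auto simp: pvimage_def)

lemma pvimage_Compl: "pvimage T (- B) = dom T \<inter> - pvimage T B"
  by (auto simp: pvimage_def dom_def)

text \<open>A point with an image lies in \<open>dom T\<close>, so its image does too. This absorbs
  the factor \<open>dom T\<close> when preimages are iterated.\<close>

lemma pvimage_dom_Int:
  assumes "\<forall>x\<in>dom T. the (T x) \<in> dom T"
  shows "pvimage T (dom T \<inter> B) = pvimage T B"
  using assms by (force simp: pvimage_def)

lemma pvimage_piterate: "pvimage (piterate T k) B = (pvimage T ^^ k) B"
proof (induction k arbitrary: B)
  case (Suc k)
  have "pvimage (piterate T (Suc k)) B = pvimage (piterate T k) (pvimage T B)"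
    by (auto simp: pvimage_def map_comp_def split: option.splits)
  also have "\<dots> = (pvimage T ^^ Suc k) B"
    by (simp only: Suc.IH funpow_Suc_right comp_apply)
  finally show ?case .
qed (auto simp: pvimage_def)

text \<open>Induction on the level. For unions of balls, the given indices of preimages are merged
  by \<open>ce_set_Union\<close>. Above that, preimage commutes with complement inside
  \<open>dom T\<close>, so the index map of the lower level is applied to each listed index.\<close>

lemma pvimage_Sigma0_set:
  assumes "computable_transformation s T"
  obtains g where "computable_fun g"
    "\<And>e. pvimage T (Sigma0_set s (Suc n) e) = dom T \<inter> Sigma0_set s (Suc n) (g e)"
proof -
  have "\<exists>g. computable_fun g \<and>
    (\<forall>e. pvimage T (Sigma0_set s (Suc n) e) = dom T \<inter> Sigma0_set s (Suc n) (g e))"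
  proof (induction n)
    case 0
    obtain f where "computable_fun f"
      and f: "\<And>i. pvimage T (ideal_ball s i) = dom T \<inter> Sigma0_set s 1 (f i)"
      using assms unfolding computable_transformation_def uniformly_def Sigma0_in_index_def by blast
    then obtain h where "computable_fun h"
      and h: "\<And>e. ce_set (h e) = (\<Union>i\<in>ce_set e. ce_set (f i))"
      using ce_set_Union by blast
    moreover have "pvimage T (Sigma0_set s (Suc 0) e) = dom T \<inter> Sigma0_set s (Suc 0) (h e)" for e
      by (auto simp: pvimage_UN f h)
    ultimately show ?case by blast
  next
    case (Suc n)
    then obtain g where "computable_fun g"
      and g: "\<And>e. pvimage T (Sigma0_set s (Suc n) e) = dom T \<inter> Sigma0_set s (Suc n) (g e)"
      by blast
    then obtain h where "computable_fun h" and h: "\<And>e. ce_set (h e) = g ` ce_set e"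
      using ce_set_image by blast
    moreover have "pvimage T (Sigma0_set s (Suc (Suc n)) e)
        = dom T \<inter> Sigma0_set s (Suc (Suc n)) (h e)" for e
      by (auto simp: pvimage_UN pvimage_Compl g h)
    ultimately show ?case by blast
  qed
  then show ?thesis using that by blast
qed

text \<open>At each positive level an index matters only through the c.e. set over which the union
  runs; at the dummy level 0 both sides are empty.\<close>

lemma Sigma0_set_UN:
  assumes "ce_set e' = (\<Union>k\<in>I. ce_set (f k))"
  shows "Sigma0_set s n e' = (\<Union>k\<in>I. Sigma0_set s n (f k))"
  by (cases "(s, n, e')" rule: Sigma0_set.cases) (use assms in auto)

lemma orbit_preimage_Sigma0:
  assumes "is_Sigma0 s n A" "n \<ge> 1"
    and "computable_transformation s T" "\<forall>x\<in>dom T. the (T x) \<in> dom T"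
  obtains U where "is_Sigma0 s n U" "(\<Union>k. (pvimage T ^^ Suc k) A) = dom T \<inter> U"
proof -
  obtain e where A: "A = Sigma0_set s n e"
    using assms by (auto simp: is_Sigma0_def)
  obtain g where cg: "computable_fun g"
    and g: "\<And>e. pvimage T (Sigma0_set s n e) = dom T \<inter> Sigma0_set s n (g e)"
    using pvimage_Sigma0_set[OF assms(3), of "n - 1"] assms(2) by auto
  obtain e' where e': "ce_set e' = (\<Union>k. ce_set ((g ^^ Suc k) e))"
    using ce_set_iterates[OF cg] by blast
  have "(pvimage T ^^ Suc k) A = dom T \<inter> Sigma0_set s n ((g ^^ Suc k) e)" for k
  proof (induction k)
    case 0
    show ?case by (simp add: A g)
  next
    case (Suc k)
    have "(pvimage T ^^ Suc (Suc k)) A = pvimage T (dom T \<inter> Sigma0_set s n ((g ^^ Suc k) e))"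
      using Suc by simp
    also have "\<dots> = dom T \<inter> Sigma0_set s n ((g ^^ Suc (Suc k)) e)"
      by (simp add: pvimage_dom_Int[OF assms(4)] g)
    finally show ?case .
  qed
  then have "(\<Union>k. (pvimage T ^^ Suc k) A) = dom T \<inter> Sigma0_set s n e'"
    unfolding Sigma0_set_UN[OF e'] by blast
  then show ?thesis by (intro that) (auto simp: is_Sigma0_def)
qed

section \<open>Recurrence\<close>

lemma pvimage_mono: "B \<subseteq> C \<Longrightarrow> pvimage T B \<subseteq> pvimage T C"
  by (auto simp: pvimage_def)

text \<open>As \<open>T\<close> is single-valued, one image point serves for all \<open>k\<close>;
  the index set is nonempty, so \<open>T x\<close> is defined.\<close>

lemma pvimage_INT: "pvimage T (\<Inter>k::nat. B k) = (\<Inter>k. pvimage T (B k))"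
proof (intro set_eqI iffI)
  fix x assume *: "x \<in> (\<Inter>k. pvimage T (B k))"
  then obtain y where y: "T x = Some y" by (auto simp: pvimage_def)
  with * have "y \<in> B k" for k by (auto simp: pvimage_def)
  with y show "x \<in> pvimage T (\<Inter>k. B k)" by (auto simp: pvimage_def)
qed (auto simp: pvimage_def)

text \<open>Ergodicity concerns sets equal to their preimage. The iterated preimages of
  \<open>E\<close> decrease and keep its measure, so their intersection is such a set and, by
  continuity from above, has the measure of \<open>E\<close>.\<close>

lemma ergodic_pvimage_subset:
  fixes \<mu> :: "'a::polish_space measure"
  assumes "prob_space \<mu>" and sets: "sets \<mu> = sets borel"
    and mpt: "measure_preserving_transformation \<mu> T" and erg: "ergodic_transformation \<mu> T"
    and E: "E \<in> sets borel" "pvimage T E \<subseteq> E"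
  shows "measure \<mu> E = 0 \<or> measure \<mu> E = 1"
proof -
  interpret prob_space \<mu> by fact
  define F where "F j = (pvimage T ^^ j) E" for j
  have F: "F j \<in> sets borel \<and> measure \<mu> (F j) = measure \<mu> E" for j
    using mpt E(1) by (induction j) (auto simp: F_def measure_preserving_transformation_def)
  have F_Suc: "F (Suc j) = pvimage T (F j)" for j by (simp add: F_def)
  have "F (Suc j) \<subseteq> F j" for j
  proof (induction j)
    case 0
    show ?case using E(2) by (simp add: F_def)
  next
    case (Suc j)
    then show ?case using pvimage_mono[OF Suc] by (simp add: F_Suc)
  qed
  then have "decseq F" by (simp add: decseq_SucI)
  have "(\<lambda>j. measure \<mu> (F j)) \<longlonglongrightarrow> measure \<mu> (\<Inter>j. F j)"
    by (rule finite_Lim_measure_decseq[OF _ \<open>decseq F\<close>]) (use F sets in auto)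
  then have "measure \<mu> (\<Inter>j. F j) = measure \<mu> E"
    using F by (simp add: LIMSEQ_const_iff)
  moreover have "pvimage T (\<Inter>j. F j) = (\<Inter>j. F j)"
  proof -
    have "pvimage T (\<Inter>j. F j) = (\<Inter>j. F (Suc j))"
      by (simp add: pvimage_INT F_Suc)
    \<comment> \<open>Dropping the first term of a decreasing sequence does not change the
      intersection.\<close>
    also have "\<dots> = (\<Inter>j. F j)"
      using \<open>\<And>j. F (Suc j) \<subseteq> F j\<close> by blast
    finally show ?thesis .
  qed
  moreover have "(\<Inter>j. F j) \<in> sets borel"
    using F by (intro sets.countable_INT'') auto
  ultimately show ?thesis
    using erg unfolding ergodic_transformation_def by metis
qed

theorem theorem2p3:
  fixes s :: "nat \<Rightarrow> 'a::polish_space"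
    and \<mu> :: "'a measure"
    and n :: nat
    and x :: 'a
    and A :: "'a set"
    and T :: "'a \<rightharpoonup> 'a"
  assumes "computable_probability_space s \<mu>"
    and "n \<ge> 1"
    and "weakly_random s \<mu> n x"
    and "is_Sigma0 s n A"
    and "measure \<mu> A > 0"
    and "measure_preserving_transformation \<mu> T"
    and "computable_transformation s T"
    and "ergodic_transformation \<mu> T"
    and "x \<in> dom T"
  shows "\<exists>k>0. \<exists>y. piterate T k x = Some y \<and> y \<in> A"
proof -
  interpret prob_space \<mu>
    using assms(1) by (simp add: computable_probability_space_def)
  have sets: "sets \<mu> = sets borel"
    using assms(1) by (simp add: computable_probability_space_def)
  then have space: "space \<mu> = UNIV"
    using sets_eq_imp_space_eq[OF sets] by simp
  have dom: "\<forall>x\<in>dom T. the (T x) \<in> dom T"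
    using assms(6) by (simp add: measure_preserving_transformation_def)
  obtain U where U: "is_Sigma0 s n U" and eq: "(\<Union>k. (pvimage T ^^ Suc k) A) = dom T \<inter> U"
    using orbit_preimage_Sigma0[OF assms(4,2,7) dom] by blast
  define E where "E = (\<Union>k. (pvimage T ^^ Suc k) A)"
  have A: "A \<in> sets borel" and U_sets: "U \<in> sets borel"
    using assms(4) U sets_Sigma0_set by (auto simp: is_Sigma0_def)
  have "(pvimage T ^^ k) A \<in> sets borel" for k
    using assms(6) A by (induction k) (auto simp: measure_preserving_transformation_def)
  then have E_sets: "E \<in> sets borel"
    unfolding E_def by blast
  \<comment> \<open>Taking the preimage removes the first term from the union.\<close>
  have "pvimage T E = (\<Union>k. (pvimage T ^^ Suc (Suc k)) A)"
    by (simp add: E_def pvimage_UN)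
  then have "pvimage T E \<subseteq> E"
    unfolding E_def by blast
  then have "measure \<mu> E = 0 \<or> measure \<mu> E = 1"
    using ergodic_pvimage_subset[OF prob_space_axioms sets assms(6,8) E_sets] by blast
  moreover have "measure \<mu> A \<le> measure \<mu> E"
  proof -
    have "(pvimage T ^^ Suc 0) A \<subseteq> E" unfolding E_def by blast
    then have "measure \<mu> (pvimage T A) \<le> measure \<mu> E"
      using E_sets sets by (intro finite_measure_mono) auto
    then show ?thesis
      using assms(6) A by (simp add: measure_preserving_transformation_def)
  qed
  ultimately have "measure \<mu> E = 1" using assms(5) by linarith
  \<comment> \<open>The argument passes from \<open>E\<close> to \<open>U\<close>, since
    \<open>E\<close> is only known to be effective relative to \<open>dom T\<close>, while
    randomness tests are sets in the whole space.\<close>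
  moreover have "measure \<mu> E \<le> measure \<mu> U"
    using eq U_sets sets by (intro finite_measure_mono) (auto simp: E_def)
  ultimately have "measure \<mu> U = 1" using prob_le_1[of U] by linarith
  then have "measure \<mu> (- U) = 0"
    using prob_compl[of U] U_sets sets by (simp add: space Compl_eq_Diff_UNIV)
  moreover have "- U \<in> sets \<mu>"
    using U_sets sets by (simp add: borel_comp)
  ultimately have "- U \<in> null_sets \<mu>"
    by (auto simp: null_sets_def emeasure_eq_measure)
  moreover have "is_Pi0 s n (- U)" using U by (simp add: is_Pi0_def)
  ultimately have "x \<in> U" using assms(3) unfolding weakly_random_def by blast
  \<comment> \<open>Membership in \<open>dom T\<close> leads back from \<open>U\<close> to
    \<open>E\<close>; the exponent \<open>Suc k\<close> makes the hitting time positive.\<close>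
  with assms(9) have "x \<in> (\<Union>k. (pvimage T ^^ Suc k) A)" unfolding eq by blast
  then obtain k where "x \<in> pvimage (piterate T (Suc k)) A"
    by (auto simp only: pvimage_piterate UN_iff)
  then show ?thesis
    unfolding pvimage_def by blast
qed

end
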